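(* There is an algorithm which, given any integer $n\ge 1$ and any column typical matrix $A\in\mathbb{R}^{3\times n}$, performs $O(n^2)$ elementary operations and either outputs a vector $x\in\mathbb{R}^n$ with $A\otimes x\in\mathbb{Z}^3$, or correctly reports that no $x\in\mathbb{R}^n$ satisfies $A\otimes x\in\mathbb{Z}^3$.
   Context: For $A=(a_{ij})\in\mathbb{R}^{m\times n}$ and $x\in\mathbb{R}^n$ the max-plus product $A\otimes x\in\mathbb{R}^m$ is defined by $(A\otimes x)_i=\max_{1\le j\le n}(a_{ij}+x_j)$. The fractional part of a real number $a$ is $fr(a)=a-\lfloor a\rfloor\in[0,1)$. A real vector is called typical if no two of its components (at different positions) have the same fractional part; a real matrix is called column typical if each of its columns is typical. Elementary operations are exact operations on real numbers, each counted at unit cost: addition, subtraction, comparison (hence maximum and minimum), and the floor and ceiling functions. *)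

theory Defs
  imports "Jordan_Normal_Form.Matrix" "HOL-Library.Landau_Symbols"
begin

section \<open>Max-plus products and typical matrices\<close>

text \<open>The number of columns varies inside the main statement, so matrices and vectors are those of
  Jordan Normal Form, whose dimensions are natural numbers and whose indices start at 0. The
  fractional part is the library's \<^const>\<open>frac\<close>.\<close>

definition maxplus_mult :: "real mat \<Rightarrow> real vec \<Rightarrow> real vec" (infixl "\<otimes>\<^sub>m" 70) where
  "A \<otimes>\<^sub>m x = vec (dim_row A) (\<lambda>i. MAX j\<in>{..<dim_col A}. A $$ (i, j) + x $ j)"

definition integral_vec :: "real vec \<Rightarrow> bool" where
  "integral_vec v \<longleftrightarrow> (\<forall>i < dim_vec v. v $ i \<in> \<int>)"

definition typical :: "real vec \<Rightarrow> bool" where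
  "typical v \<longleftrightarrow> (\<forall>i < dim_vec v. \<forall>k < dim_vec v. i \<noteq> k \<longrightarrow> frac (v $ i) \<noteq> frac (v $ k))"

definition column_typical :: "real mat \<Rightarrow> bool" where
  "column_typical A \<longleftrightarrow> (\<forall>j < dim_col A. typical (col A j))"

section \<open>Algorithms over the reals with unit-cost operations\<close>

text \<open>An algorithm is a single program, independent of the size of the input. It works on natural
  number index variables and on arrays of reals. The only operations on reals are addition,
  subtraction, comparison (with maximum and minimum), floor and ceiling, besides the constants 0 and
  1; there is no multiplication, and a real can influence indices only through comparisons.\<close>

datatype ivar = Size | Verdict | Local nat

datatype arr = Input nat | Output | Work nat

datatype iexp =
    IConst nat
  | IVar ivar
  | IPlus iexp iexp
  | IMinus iexp iexp

datatype rexp =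
    RZero
  | ROne
  | Cell arr iexp
  | RPlus rexp rexp
  | RMinus rexp rexp
  | RMax rexp rexp
  | RMin rexp rexp
  | RFloor rexp
  | RCeiling rexp

datatype test =
    ILess iexp iexp
  | RLess rexp rexp

datatype com =
    Skip
  | IAssign ivar iexp
  | RAssign arr iexp rexp
  | Seq com com
  | Cond test com com
  | While test com

record state =
  ivars :: "ivar \<Rightarrow> nat"
  cells :: "arr \<Rightarrow> nat \<Rightarrow> real"

primrec ival :: "iexp \<Rightarrow> state \<Rightarrow> nat" where
  "ival (IConst k) s = k"
| "ival (IVar v) s = ivars s v"
| "ival (IPlus a b) s = ival a s + ival b s"
| "ival (IMinus a b) s = ival a s - ival b s"

primrec rval :: "rexp \<Rightarrow> state \<Rightarrow> real" where
  "rval RZero s = 0"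
| "rval ROne s = 1"
| "rval (Cell a i) s = cells s a (ival i s)"
| "rval (RPlus a b) s = rval a s + rval b s"
| "rval (RMinus a b) s = rval a s - rval b s"
| "rval (RMax a b) s = max (rval a s) (rval b s)"
| "rval (RMin a b) s = min (rval a s) (rval b s)"
| "rval (RFloor a) s = of_int \<lfloor>rval a s\<rfloor>"
| "rval (RCeiling a) s = of_int \<lceil>rval a s\<rceil>"

primrec tval :: "test \<Rightarrow> state \<Rightarrow> bool" where
  "tval (ILess a b) s \<longleftrightarrow> ival a s < ival b s"
| "tval (RLess a b) s \<longleftrightarrow> rval a s < rval b s"

text \<open>Every operation costs one unit: not only the elementary operations on reals, but also index
  arithmetic, index comparisons, memory accesses and assignments. The cost of a run is therefore an
  upper bound for its number of elementary operations, and no work is hidden in the control flow.\<close>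

primrec icost :: "iexp \<Rightarrow> nat" where
  "icost (IConst k) = 1"
| "icost (IVar v) = 1"
| "icost (IPlus a b) = 1 + icost a + icost b"
| "icost (IMinus a b) = 1 + icost a + icost b"

primrec rcost :: "rexp \<Rightarrow> nat" where
  "rcost RZero = 1"
| "rcost ROne = 1"
| "rcost (Cell a i) = 1 + icost i"
| "rcost (RPlus a b) = 1 + rcost a + rcost b"
| "rcost (RMinus a b) = 1 + rcost a + rcost b"
| "rcost (RMax a b) = 1 + rcost a + rcost b"
| "rcost (RMin a b) = 1 + rcost a + rcost b"
| "rcost (RFloor a) = 1 + rcost a"
| "rcost (RCeiling a) = 1 + rcost a"

primrec tcost :: "test \<Rightarrow> nat" where
  "tcost (ILess a b) = 1 + icost a + icost b"
| "tcost (RLess a b) = 1 + rcost a + rcost b"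

definition set_ivar :: "ivar \<Rightarrow> nat \<Rightarrow> state \<Rightarrow> state" where
  "set_ivar v k s = s\<lparr>ivars := (ivars s)(v := k)\<rparr>"

definition set_cell :: "arr \<Rightarrow> nat \<Rightarrow> real \<Rightarrow> state \<Rightarrow> state" where
  "set_cell a k r s = s\<lparr>cells := (cells s)(a := (cells s a)(k := r))\<rparr>"

text \<open>\<open>exec c s t s'\<close>: started in \<open>s\<close>, program \<open>c\<close> terminates in \<open>s'\<close> at total cost \<open>t\<close>.\<close>

inductive exec :: "com \<Rightarrow> state \<Rightarrow> nat \<Rightarrow> state \<Rightarrow> bool" where
  Skip: "exec Skip s 1 s"
| IAssign: "exec (IAssign v e) s (1 + icost e) (set_ivar v (ival e s) s)"
| RAssign: "exec (RAssign a i e) s (1 + icost i + rcost e) (set_cell a (ival i s) (rval e s) s)"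
| Seq: "exec c s t s' \<Longrightarrow> exec d s' u s'' \<Longrightarrow> exec (Seq c d) s (t + u) s''"
| CondTrue: "tval b s \<Longrightarrow> exec c s t s' \<Longrightarrow> exec (Cond b c d) s (tcost b + t) s'"
| CondFalse: "\<not> tval b s \<Longrightarrow> exec d s t s' \<Longrightarrow> exec (Cond b c d) s (tcost b + t) s'"
| WhileFalse: "\<not> tval b s \<Longrightarrow> exec (While b c) s (tcost b) s"
| WhileTrue: "tval b s \<Longrightarrow> exec c s t s' \<Longrightarrow> exec (While b c) s' u s'' \<Longrightarrow>
    exec (While b c) s (tcost b + t + u) s''"

inductive_cases exec_cases:
  "exec Skip s t s'"
  "exec (IAssign v e) s t s'"
  "exec (RAssign a i e) s t s'"
  "exec (Seq c d) s t s'"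
  "exec (Cond b c d) s t s'"
  "exec (While b c) s t s'"

lemma exec_deterministic:
  "exec c s t s' \<Longrightarrow> exec c s u s'' \<Longrightarrow> t = u \<and> s' = s''"
proof (induction arbitrary: u s'' rule: exec.induct)
  case (Seq c s t s' d u' r)
  then show ?case by (elim exec_cases) blast
next
  case (CondTrue b s c t s' d)
  then show ?case by (elim exec_cases) blast+
next
  case (CondFalse b s d t s' c)
  then show ?case by (elim exec_cases) blast+
next
  case (WhileFalse b s c)
  from WhileFalse.prems WhileFalse.hyps show ?case by (cases rule: exec.cases) auto
next
  case (WhileTrue b s c t s' u' r)
  from WhileTrue.prems WhileTrue.hyps(1) WhileTrue.IH show ?case
    by (cases rule: exec.cases) blast+
qed (auto elim: exec_cases)

text \<open>The number of columns is given in \<^const>\<open>Size\<close> and row \<open>i\<close> of the matrix in the array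
  \<open>Input i\<close>; all other memory is 0.\<close>

definition initial_state :: "real mat \<Rightarrow> state" where
  "initial_state A = \<lparr>
     ivars = (\<lambda>v. if v = Size then dim_col A else 0),
     cells = (\<lambda>a j. case a of
         Input i \<Rightarrow> if i < dim_row A \<and> j < dim_col A then A $$ (i, j) else 0
       | _ \<Rightarrow> 0)\<rparr>"

text \<open>The answer is negative if \<^const>\<open>Verdict\<close> is 0 in the end; otherwise it is the vector formed
  by the first \<open>n\<close> cells of \<^const>\<open>Output\<close>.\<close>

definition answer :: "nat \<Rightarrow> state \<Rightarrow> real vec option" where
  "answer n s = (if ivars s Verdict = 0 then None else Some (vec n (cells s Output)))"

end

(* A vector z is in the image iff every row i attains the minimum of z_k - a_kj over k in some
   column j. By translation only integral z = (u, v, 0) matter. Fix the column that serves the first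
   row: its constraints are u <= p and u - v <= q with integers p, q. Increasing u only relaxes the
   constraints of the other two rows, so u = min p (v + q), and one integer unknown v remains. The
   admissible columns for the third row give lower bounds for v, those for the second row upper
   bounds, and it suffices to compare the smallest lower bound with the upper bounds. This takes
   linear time for each choice of the first column. *)

theory Submission
  imports Defs
begin

section \<open>Total correctness with running times\<close>

definition terminates_with :: "com \<Rightarrow> (nat \<Rightarrow> state \<Rightarrow> bool) \<Rightarrow> state \<Rightarrow> bool" where
  "terminates_with c Q s \<longleftrightarrow> (\<exists>t s'. exec c s t s' \<and> Q t s')"

text \<open>Inversion of \<open>exec\<close> gives the weakest precondition of every construct
  except \<open>While\<close>, so simplification computes the final state and the exact cost of
  loop-free code.\<close>

lemma terminates_with_simps [simp]:
  "terminates_with Skip Q s \<longleftrightarrow> Q 1 s"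
  "terminates_with (IAssign v e) Q s \<longleftrightarrow> Q (1 + icost e) (set_ivar v (ival e s) s)"
  "terminates_with (RAssign a i r) Q s \<longleftrightarrow>
     Q (1 + icost i + rcost r) (set_cell a (ival i s) (rval r s) s)"
  "terminates_with (Seq c d) Q s \<longleftrightarrow>
     terminates_with c (\<lambda>t. terminates_with d (\<lambda>u. Q (t + u))) s"
  "terminates_with (Cond b c d) Q s \<longleftrightarrow>
     terminates_with (if tval b s then c else d) (\<lambda>t. Q (tcost b + t)) s"
proof -
  show "terminates_with Skip Q s \<longleftrightarrow> Q 1 s"
    unfolding terminates_with_def by (metis exec.Skip exec_cases(1))
  show "terminates_with (IAssign v e) Q s \<longleftrightarrow> Q (1 + icost e) (set_ivar v (ival e s) s)"
    unfolding terminates_with_def by (metis exec.IAssign exec_cases(2))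
  show "terminates_with (RAssign a i r) Q s \<longleftrightarrow>
      Q (1 + icost i + rcost r) (set_cell a (ival i s) (rval r s) s)"
    unfolding terminates_with_def by (metis exec.RAssign exec_cases(3))
  show "terminates_with (Seq c d) Q s \<longleftrightarrow>
      terminates_with c (\<lambda>t. terminates_with d (\<lambda>u. Q (t + u))) s"
    unfolding terminates_with_def by (blast intro: exec.Seq elim: exec_cases(4))
  show "terminates_with (Cond b c d) Q s \<longleftrightarrow>
      terminates_with (if tval b s then c else d) (\<lambda>t. Q (tcost b + t)) s"
    unfolding terminates_with_def
    by (cases "tval b s") (auto intro: exec.CondTrue exec.CondFalse elim!: exec_cases(5))
qed

definition for_loop :: "ivar \<Rightarrow> com \<Rightarrow> com" where
  "for_loop v c = Seq (IAssign v (IConst 0))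
     (While (ILess (IVar v) (IVar Size)) (Seq c (IAssign v (IPlus (IVar v) (IConst 1)))))"

text \<open>The constants 5 and 7 are the overhead of \<^const>\<open>for_loop\<close>: 2 for the initialization, 3 for
  each test and 4 for each increment.\<close>

lemma terminates_with_for_loop:
  assumes init: "I 0 (set_ivar v 0 s)"
    and index: "\<And>k s. I k s \<Longrightarrow> ivars s v = k \<and> ivars s Size = n"
    and step: "\<And>k s. k < n \<Longrightarrow> I k s \<Longrightarrow>
      terminates_with c (\<lambda>t s'. t \<le> K \<and> I (Suc k) (set_ivar v (Suc (ivars s' v)) s')) s"
    and final: "\<And>t s'. t \<le> 5 + n * (K + 7) \<Longrightarrow> I n s' \<Longrightarrow> Q t s'"
  shows "terminates_with (for_loop v c) Q s"
proof -
  let ?test = "ILess (IVar v) (IVar Size)"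
  let ?body = "Seq c (IAssign v (IPlus (IVar v) (IConst 1)))"
  have loop: "\<exists>t s'. exec (While ?test ?body) s t s' \<and> t \<le> 3 + (n - k) * (K + 7) \<and> I n s'"
    if "k \<le> n" "I k s" for k s
    using that
  proof (induction "n - k" arbitrary: k s)
    case 0
    then have "k = n" by simp
    moreover have "exec (While ?test ?body) s (tcost ?test) s"
      using index[OF \<open>I k s\<close>] \<open>k = n\<close> by (intro exec.WhileFalse) simp
    ultimately show ?case using 0 by (intro exI[of _ "tcost ?test"] exI[of _ s]) simp
  next
    case (Suc m)
    then have "k < n" by simp
    then obtain t s' where body: "exec c s t s'" "t \<le> K"
      "I (Suc k) (set_ivar v (Suc (ivars s' v)) s')"
      using step Suc.prems unfolding terminates_with_def by blast
    from Suc.hyps(1)[of "Suc k", OF _ _ body(3)] Suc.hyps(2) \<open>k < n\<close>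
    obtain t' s'' where rest: "exec (While ?test ?body) (set_ivar v (Suc (ivars s' v)) s') t' s''"
      "t' \<le> 3 + (n - Suc k) * (K + 7)" "I n s''" by force
    let ?step = "t + (1 + icost (IPlus (IVar v) (IConst 1)))"
    have "exec ?body s ?step (set_ivar v (Suc (ivars s' v)) s')"
      using exec.Seq[OF body(1) exec.IAssign[of v "IPlus (IVar v) (IConst 1)"]] by simp
    then have "exec (While ?test ?body) s (tcost ?test + ?step + t') s''"
      using index[OF \<open>I k s\<close>] \<open>k < n\<close> rest(1) by (intro exec.WhileTrue) auto
    moreover have "n - k = Suc (n - Suc k)" using \<open>k < n\<close> by simp
    then have "tcost ?test + ?step + t' \<le> 3 + (n - k) * (K + 7)"
      using rest(2) body(2) by simp
    ultimately show ?case using rest(3) by blast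
  qed
  from loop[OF _ init] obtain t s' where
    "exec (While ?test ?body) (set_ivar v 0 s) t s'" "t \<le> 3 + n * (K + 7)" "I n s'" by auto
  moreover from this have "exec (for_loop v c) s (2 + t) s'"
    using exec.Seq[OF exec.IAssign[of v "IConst 0" s]] unfolding for_loop_def by simp
  ultimately show ?thesis
    unfolding terminates_with_def using final[of "2 + t" s'] by auto
qed

section \<open>Integral image vectors of matrices with three rows\<close>

text \<open>\<open>a\<close>, \<open>b\<close>, \<open>c\<close> are the rows. The integral vector \<open>(u, v, 0)\<close> is in the image if every row
  attains the minimum of \<open>z\<^sub>k - A\<^sub>k\<^sub>j\<close> over the rows \<open>k\<close> in some column \<open>j\<close>.\<close>

definition image_point ::
  "(nat \<Rightarrow> real) \<Rightarrow> (nat \<Rightarrow> real) \<Rightarrow> (nat \<Rightarrow> real) \<Rightarrow> nat \<Rightarrow> real \<Rightarrow> real \<Rightarrow> bool" where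
  "image_point a b c n u v \<longleftrightarrow> u \<in> \<int> \<and> v \<in> \<int> \<and>
     (\<exists>j<n. u \<le> a j - c j \<and> u - v \<le> a j - b j) \<and>
     (\<exists>j<n. v \<le> b j - c j \<and> v - u \<le> b j - a j) \<and>
     (\<exists>j<n. a j - c j \<le> u \<and> b j - c j \<le> v)"

text \<open>For integral \<open>u\<close> and \<open>v\<close> the first-row constraints of column
  \<open>i\<close> can be rounded to \<open>u \<le> p\<close> and \<open>u - v \<le> q\<close>,
  where p is \<open>floor_diff a c i\<close> and q is \<open>floor_diff a b i\<close>.\<close>

definition floor_diff :: "(nat \<Rightarrow> real) \<Rightarrow> (nat \<Rightarrow> real) \<Rightarrow> nat \<Rightarrow> real" where
  "floor_diff a b i = of_int \<lfloor>a i - b i\<rfloor>"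

text \<open>With \<open>u = min p (v + q)\<close>, the third-row constraints of column
  \<open>j\<close> become \<open>a j - c j \<le> p\<close>, which is free of \<open>v\<close> and
  tested separately, and this bound on \<open>v\<close>, rounded up because \<open>v\<close> is
  integral.\<close>

definition lower_bound ::
  "(nat \<Rightarrow> real) \<Rightarrow> (nat \<Rightarrow> real) \<Rightarrow> (nat \<Rightarrow> real) \<Rightarrow> nat \<Rightarrow> nat \<Rightarrow> real" where
  "lower_bound a b c i j = of_int \<lceil>max (b j - c j) (a j - c j - floor_diff a b i)\<rceil>"

definition upper_bound ::
  "(nat \<Rightarrow> real) \<Rightarrow> (nat \<Rightarrow> real) \<Rightarrow> (nat \<Rightarrow> real) \<Rightarrow> nat \<Rightarrow> nat \<Rightarrow> real" where
  "upper_bound a b c i j = min (b j - c j) (floor_diff a c i + (b j - a j))"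

text \<open>For \<open>u = min p (v + q)\<close> one has \<open>v - u = max (v - p) (- q)\<close>,
  so the second-row constraints split into a condition free of \<open>v\<close> and an upper bound
  on \<open>v\<close>.\<close>

definition compatible ::
  "(nat \<Rightarrow> real) \<Rightarrow> (nat \<Rightarrow> real) \<Rightarrow> (nat \<Rightarrow> real) \<Rightarrow> nat \<Rightarrow> nat \<Rightarrow> real \<Rightarrow> bool" where
  "compatible a b c i j v \<longleftrightarrow> - floor_diff a b i \<le> b j - a j \<and> v \<le> upper_bound a b c i j"

text \<open>For this \<open>v\<close>, the first component is the largest integer that column
  \<open>i\<close> allows; columns \<open>i\<close>, \<open>j\<close>, \<open>k\<close> serve the
  first, second and third row.\<close>

lemma image_pointI:
  assumes "i < n" "j < n" "k < n"
    and "a k - c k \<le> floor_diff a c i"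
    and "compatible a b c i j (lower_bound a b c i k)"
  shows "image_point a b c n
    (min (floor_diff a c i) (lower_bound a b c i k + floor_diff a b i)) (lower_bound a b c i k)"
proof -
  let ?v = "lower_bound a b c i k"
  let ?u = "min (floor_diff a c i) (?v + floor_diff a b i)"
  have floors: "floor_diff a c i \<le> a i - c i" "floor_diff a b i \<le> a i - b i"
    unfolding floor_diff_def by simp_all
  have v: "max (b k - c k) (a k - c k - floor_diff a b i) \<le> ?v"
    unfolding lower_bound_def by (rule le_of_int_ceiling)
  have ints: "?v \<in> \<int>" "floor_diff a c i \<in> \<int>" "floor_diff a b i \<in> \<int>"
    by (simp_all add: lower_bound_def floor_diff_def)
  then have "?u \<in> \<int>" by (auto simp: min_def)
  moreover have "?u \<le> a i - c i" "?u - ?v \<le> a i - b i" using floors by linarith+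
  moreover have "?v \<le> b j - c j" "?v - ?u \<le> b j - a j"
    using assms(5) unfolding compatible_def upper_bound_def by linarith+
  moreover have "a k - c k \<le> ?u" "b k - c k \<le> ?v" using v assms(4) by linarith+
  ultimately show ?thesis using assms(1-3) ints(1) unfolding image_point_def by blast
qed

text \<open>Once the column \<open>i\<close> for the first row is fixed, \<open>u\<close> may be increased until one of the two
  constraints of that row is tight: this only relaxes those of the other rows.\<close>

lemma image_pointE:
  assumes "image_point a b c n u v"
  obtains i j k where "i < n" "j < n" "k < n" "a k - c k \<le> floor_diff a c i"
    "\<And>l. l \<le> lower_bound a b c i k \<Longrightarrow> compatible a b c i j l"
proof -
  from assms obtain i j k where ijk: "i < n" "j < n" "k < n"
    and i: "u \<le> a i - c i" "u - v \<le> a i - b i"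
    and j: "v \<le> b j - c j" "v - u \<le> b j - a j"
    and k: "a k - c k \<le> u" "b k - c k \<le> v"
    and ints: "u \<in> \<int>" "v \<in> \<int>"
    unfolding image_point_def by blast
  from ints obtain u' v' where uv: "u = of_int u'" "v = of_int v'" by (auto elim!: Ints_cases)
  have p: "u \<le> floor_diff a c i"
    using i(1) unfolding floor_diff_def uv by (simp add: le_floor_iff)
  have "u' - v' \<le> \<lfloor>a i - b i\<rfloor>"
    using i(2) unfolding uv by (simp add: le_floor_iff)
  then have "real_of_int (u' - v') \<le> real_of_int \<lfloor>a i - b i\<rfloor>" by (simp only: of_int_le_iff)
  then have q: "u - v \<le> floor_diff a b i"
    unfolding floor_diff_def uv by simp
  have "\<lceil>max (b k - c k) (a k - c k - floor_diff a b i)\<rceil> \<le> v'"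
    using k q unfolding uv by (simp add: ceiling_le_iff)
  then have v: "lower_bound a b c i k \<le> v"
    unfolding lower_bound_def uv by (simp only: of_int_le_iff)
  show ?thesis
  proof (rule that[OF ijk])
    show "a k - c k \<le> floor_diff a c i" using k p by linarith
    fix l assume "l \<le> lower_bound a b c i k"
    then show "compatible a b c i j l"
      using v p q j unfolding compatible_def upper_bound_def by linarith
  qed
qed

section \<open>Integral image points and solutions of the max-plus problem\<close>

lemma maxplus_mult_index:
  assumes "A \<in> carrier_mat m n" "i < m"
  shows "(A \<otimes>\<^sub>m x) $ i = (MAX j\<in>{..<n}. A $$ (i, j) + x $ j)"
  using assms unfolding maxplus_mult_def by auto

lemma all_less_3: "(\<forall>i<3. P i) \<longleftrightarrow> P 0 \<and> P 1 \<and> P (2::nat)"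
  by (auto simp: numeral_3_eq_3 numeral_2_eq_2 less_Suc_eq)

text \<open>This \<open>x\<close> is the greatest vector whose image is at most
  \<open>(u, v, 0)\<close>; a column that serves a row attains equality there.\<close>

lemma image_point_solution:
  fixes A :: "real mat"
  defines "a \<equiv> (\<lambda>j. A $$ (0, j))" and "b \<equiv> (\<lambda>j. A $$ (1, j))" and "c \<equiv> (\<lambda>j. A $$ (2, j))"
  assumes A: "A \<in> carrier_mat 3 n" and uv: "image_point a b c n u v"
    and x: "\<And>j. j < n \<Longrightarrow> x $ j = min (u - a j) (min (v - b j) (- c j))"
  shows "integral_vec (A \<otimes>\<^sub>m x)"
proof -
  from uv obtain i j k where ijk: "i < n" "j < n" "k < n"
    and i: "u \<le> a i - c i" "u - v \<le> a i - b i"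
    and j: "v \<le> b j - c j" "v - u \<le> b j - a j"
    and k: "a k - c k \<le> u" "b k - c k \<le> v"
    and ints: "u \<in> \<int>" "v \<in> \<int>"
    unfolding image_point_def by blast
  have "(MAX j\<in>{..<n}. a j + x $ j) = u"
    by (rule Max_eqI) (use ijk i x in \<open>force simp: image_iff\<close>)+
  moreover have "(MAX j\<in>{..<n}. b j + x $ j) = v"
    by (rule Max_eqI) (use ijk j x in \<open>force simp: image_iff\<close>)+
  moreover have "(MAX j\<in>{..<n}. c j + x $ j) = 0"
    by (rule Max_eqI) (use ijk k x in \<open>force simp: image_iff\<close>)+
  moreover have "dim_vec (A \<otimes>\<^sub>m x) = 3" using A unfolding maxplus_mult_def by simp
  ultimately show ?thesis
    using ints unfolding integral_vec_def a_def b_def c_def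
    by (simp add: all_less_3 maxplus_mult_index[OF A])
qed

text \<open>Columns attaining the three maxima serve the rows; \<open>n \<ge> 1\<close> makes the
  maxima attained. Subtracting the third component normalizes it to 0 and keeps integrality.\<close>

lemma solution_image_point:
  fixes A :: "real mat"
  defines "a \<equiv> (\<lambda>j. A $$ (0, j))" and "b \<equiv> (\<lambda>j. A $$ (1, j))" and "c \<equiv> (\<lambda>j. A $$ (2, j))"
  assumes A: "A \<in> carrier_mat 3 n" and "n \<ge> 1" and x: "integral_vec (A \<otimes>\<^sub>m x)"
  shows "\<exists>u v. image_point a b c n u v"
proof -
  define z where "z r = (MAX j\<in>{..<n}. r j + x $ j)" for r :: "nat \<Rightarrow> real"
  have "dim_vec (A \<otimes>\<^sub>m x) = 3" using A unfolding maxplus_mult_def by simp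
  then have ints: "z a \<in> \<int>" "z b \<in> \<int>" "z c \<in> \<int>"
    using x unfolding integral_vec_def z_def a_def b_def c_def
    by (simp_all add: all_less_3 maxplus_mult_index[OF A])
  have le: "r j + x $ j \<le> z r" if "j < n" for r j
    unfolding z_def using that by (intro Max_ge) auto
  have attained: "\<exists>j<n. z r = r j + x $ j" for r
  proof -
    have "z r \<in> (\<lambda>j. r j + x $ j) ` {..<n}"
      unfolding z_def using \<open>n \<ge> 1\<close> by (intro Max_in) (auto simp: lessThan_empty_iff)
    then show ?thesis by auto
  qed
  obtain i j k where "i < n" "z a = a i + x $ i" "j < n" "z b = b j + x $ j"
    "k < n" "z c = c k + x $ k"
    using attained by meson
  moreover from this have "b i + x $ i \<le> z b" "c i + x $ i \<le> z c" "a j + x $ j \<le> z a"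
    "c j + x $ j \<le> z c" "a k + x $ k \<le> z a" "b k + x $ k \<le> z b"
    using le by blast+
  ultimately have "image_point a b c n (z a - z c) (z b - z c)"
    unfolding image_point_def using ints
    by (intro conjI) (auto intro: exI[of _ i] exI[of _ j] exI[of _ k])
  then show ?thesis by blast
qed

section \<open>The program\<close>

abbreviation entry :: "nat \<Rightarrow> nat \<Rightarrow> rexp" where
  "entry r k \<equiv> Cell (Input r) (IVar (Local k))"

abbreviation reg :: "nat \<Rightarrow> rexp" where
  "reg k \<equiv> Cell (Work k) (IConst 0)"

abbreviation floor_diff_exp :: "nat \<Rightarrow> nat \<Rightarrow> rexp" where
  "floor_diff_exp r s \<equiv> RFloor (RMinus (entry r 0) (entry s 0))"

abbreviation lower_bound_exp :: rexp where
  "lower_bound_exp \<equiv> RCeiling (RMax (RMinus (entry 1 1) (entry 2 1))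
     (RMinus (RMinus (entry 0 1) (entry 2 1)) (floor_diff_exp 0 1)))"

abbreviation upper_bound_exp :: rexp where
  "upper_bound_exp \<equiv> RMin (RMinus (entry 1 1) (entry 2 1))
     (RPlus (floor_diff_exp 0 2) (RMinus (entry 1 1) (entry 0 1)))"

text \<open>\<open>Local 0\<close> is the column \<open>i\<close>, \<open>Local 1\<close> the index of the inner loops, and \<open>Local 2\<close> tells
  whether \<open>Work 0\<close> already holds a lower bound for \<open>v\<close>. The point that is found is stored in
  \<open>Work 1\<close> and \<open>Work 2\<close>.\<close>

definition lower_step :: com where
  "lower_step = Cond (RLess (floor_diff_exp 0 2) (RMinus (entry 0 1) (entry 2 1))) Skip
     (Cond (ILess (IConst 0) (IVar (Local 2)))
        (RAssign (Work 0) (IConst 0) (RMin (reg 0) lower_bound_exp))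
        (Seq (RAssign (Work 0) (IConst 0) lower_bound_exp) (IAssign (Local 2) (IConst 1))))"

text \<open>Only strict comparison is available, so the negated conditions are tested and lead to
  \<open>Skip\<close>. A later success overwrites the stored point by another valid one.\<close>

definition upper_step :: com where
  "upper_step = Cond (ILess (IConst 0) (IVar (Local 2)))
     (Cond (RLess (RMinus (entry 1 1) (entry 0 1)) (RMinus RZero (floor_diff_exp 0 1))) Skip
       (Cond (RLess upper_bound_exp (reg 0)) Skip
         (Seq (RAssign (Work 1) (IConst 0)
                (RMin (floor_diff_exp 0 2) (RPlus (reg 0) (floor_diff_exp 0 1))))
           (Seq (RAssign (Work 2) (IConst 0) (reg 0)) (IAssign Verdict (IConst 1))))))
     Skip"

definition output_step :: com where
  "output_step = RAssign Output (IVar (Local 1)) (RMin (RMinus (reg 1) (entry 0 1))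
     (RMin (RMinus (reg 2) (entry 1 1)) (RMinus RZero (entry 2 1))))"

definition column_step :: com where
  "column_step = Seq (IAssign (Local 2) (IConst 0))
     (Seq (for_loop (Local 1) lower_step) (for_loop (Local 1) upper_step))"

text \<open>The output loop also runs after a negative verdict; \<open>answer\<close> then ignores
  what it wrote.\<close>

definition solver :: com where
  "solver = Seq (for_loop (Local 0) column_step) (for_loop (Local 1) output_step)"

section \<open>Loop invariants\<close>

locale three_rows =
  fixes a b c :: "nat \<Rightarrow> real" and n :: nat
begin

definition loaded :: "state \<Rightarrow> bool" where
  "loaded s \<longleftrightarrow> ivars s Size = n \<and>
     cells s (Input 0) = a \<and> cells s (Input 1) = b \<and> cells s (Input 2) = c"

definition sound :: "state \<Rightarrow> bool" where
  "sound s \<longleftrightarrow> (ivars s Verdict \<noteq> 0 \<longrightarrow>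
     image_point a b c n (cells s (Work 1) 0) (cells s (Work 2) 0))"

text \<open>Denies what \<open>image_pointE\<close> yields for column \<open>i\<close>. Quantifying
  over all smaller \<open>l\<close> lets the least lower bound stand in for that of
  \<open>k\<close>.\<close>

definition refuted :: "nat \<Rightarrow> bool" where
  "refuted i \<longleftrightarrow> \<not> (\<exists>j<n. \<exists>k<n. a k - c k \<le> floor_diff a c i \<and>
     (\<forall>l \<le> lower_bound a b c i k. compatible a b c i j l))"

definition column_inv :: "nat \<Rightarrow> state \<Rightarrow> bool" where
  "column_inv i s \<longleftrightarrow> loaded s \<and> ivars s (Local 0) = i \<and> sound s \<and>
     (ivars s Verdict = 0 \<longrightarrow> (\<forall>i'<i. refuted i'))"

text \<open>\<open>l\<close> is the minimum of the lower bounds over the first \<open>m\<close> columns, unless it is a minimum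
  over the empty set, in which case \<open>f\<close> is 0.\<close>

definition has_minimum :: "nat \<Rightarrow> nat \<Rightarrow> nat \<Rightarrow> real \<Rightarrow> bool" where
  "has_minimum i m f l \<longleftrightarrow>
     (if f = 0 then \<forall>k<m. \<not> a k - c k \<le> floor_diff a c i
      else (\<exists>k<m. a k - c k \<le> floor_diff a c i \<and> l = lower_bound a b c i k) \<and>
        (\<forall>k<m. a k - c k \<le> floor_diff a c i \<longrightarrow> l \<le> lower_bound a b c i k))"

definition lower_inv :: "nat \<Rightarrow> nat \<Rightarrow> state \<Rightarrow> bool" where
  "lower_inv i m s \<longleftrightarrow> column_inv i s \<and> ivars s (Local 1) = m \<and>
     has_minimum i m (ivars s (Local 2)) (cells s (Work 0) 0)"

definition upper_inv :: "nat \<Rightarrow> nat \<Rightarrow> state \<Rightarrow> bool" where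
  "upper_inv i m s \<longleftrightarrow> column_inv i s \<and> ivars s (Local 1) = m \<and>
     has_minimum i n (ivars s (Local 2)) (cells s (Work 0) 0) \<and>
     (ivars s Verdict = 0 \<and> ivars s (Local 2) \<noteq> 0 \<longrightarrow>
       (\<forall>j<m. \<not> compatible a b c i j (cells s (Work 0) 0)))"

text \<open>Overwriting \<open>Local 0\<close> frees \<open>column_inv\<close> from the actual value
  of the outer index.\<close>

definition output_inv :: "nat \<Rightarrow> state \<Rightarrow> bool" where
  "output_inv m s \<longleftrightarrow> column_inv n (set_ivar (Local 0) n s) \<and> ivars s (Local 1) = m \<and>
     (\<forall>j<m. cells s Output j =
        min (cells s (Work 1) 0 - a j) (min (cells s (Work 2) 0 - b j) (- c j)))"

lemmas invs = loaded_def sound_def column_inv_def lower_inv_def upper_inv_def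
  output_inv_def set_ivar_def set_cell_def

lemma inv_index:
  "column_inv i s \<Longrightarrow> ivars s (Local 0) = i \<and> ivars s Size = n"
  "lower_inv i m s \<Longrightarrow> ivars s (Local 1) = m \<and> ivars s Size = n"
  "upper_inv i m s \<Longrightarrow> ivars s (Local 1) = m \<and> ivars s Size = n"
  "output_inv m s \<Longrightarrow> ivars s (Local 1) = m \<and> ivars s Size = n"
  by (auto simp: invs)

section \<open>The running minimum and the loop bodies\<close>

lemma has_minimum_first:
  assumes "has_minimum i m 0 l" "a m - c m \<le> floor_diff a c i"
  shows "has_minimum i (Suc m) (Suc 0) (lower_bound a b c i m)"
  using assms unfolding has_minimum_def by (auto simp: less_Suc_eq)

lemma has_minimum_next:
  assumes "has_minimum i m f l" "f \<noteq> 0" "a m - c m \<le> floor_diff a c i"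
  shows "has_minimum i (Suc m) f (min l (lower_bound a b c i m))"
proof -
  have min: "\<exists>k<m. a k - c k \<le> floor_diff a c i \<and> l = lower_bound a b c i k"
    "\<forall>k<m. a k - c k \<le> floor_diff a c i \<longrightarrow> l \<le> lower_bound a b c i k"
    using assms(1) unfolding has_minimum_def if_not_P[OF assms(2)] by blast+
  have "\<forall>k<Suc m. a k - c k \<le> floor_diff a c i \<longrightarrow>
      min l (lower_bound a b c i m) \<le> lower_bound a b c i k"
    using min(2) by (metis less_Suc_eq min.coboundedI1 min.cobounded2)
  moreover have "\<exists>k<Suc m. a k - c k \<le> floor_diff a c i \<and>
      min l (lower_bound a b c i m) = lower_bound a b c i k"
    using min(1) assms(3) unfolding min_def by (metis less_Suc_eq)
  ultimately show ?thesis
    unfolding has_minimum_def if_not_P[OF assms(2)] by blast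
qed

lemma has_minimum_skip:
  assumes "has_minimum i m f l" "\<not> a m - c m \<le> floor_diff a c i"
  shows "has_minimum i (Suc m) f l"
proof (cases "f = 0")
  case True
  then show ?thesis using assms unfolding has_minimum_def by (auto simp: less_Suc_eq)
next
  case False
  then show ?thesis
    using assms unfolding has_minimum_def if_not_P[OF False] less_Suc_eq by blast
qed

text \<open>The cases are an inadmissible column, the first admissible one and a later one. The
  constant 100 is a crude cost bound shared by all three inner loop bodies.\<close>

lemma lower_step:
  assumes "lower_inv i m s"
  shows "terminates_with lower_step
    (\<lambda>t s'. t \<le> 100 \<and> lower_inv i (Suc m) (set_ivar (Local 1) (Suc (ivars s' (Local 1))) s')) s"
proof -
  have m: "ivars s (Local 1) = m" and inv: "column_inv i s"
    and min: "has_minimum i m (ivars s (Local 2)) (cells s (Work 0) 0)"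
    using assms by (simp_all add: lower_inv_def)
  have exps: "rval (floor_diff_exp 0 2) s = floor_diff a c i"
    "rval (RMinus (entry 0 1) (entry 2 1)) s = a m - c m"
    "rval lower_bound_exp s = lower_bound a b c i m"
    using m inv by (simp_all add: column_inv_def loaded_def floor_diff_def lower_bound_def)
  show ?thesis
  proof (cases "a m - c m \<le> floor_diff a c i")
    case False
    have "lower_inv i (Suc m) (set_ivar (Local 1) (Suc m) s)"
      using has_minimum_skip[OF min False] inv
      by (simp add: lower_inv_def column_inv_def loaded_def sound_def set_ivar_def)
    then show ?thesis using False m unfolding lower_step_def
      by (simp add: exps[unfolded One_nat_def] del: rval.simps)
  next
    case True
    let ?l = "lower_bound a b c i m"
    show ?thesis
    proof (cases "ivars s (Local 2) = 0")
      case empty: True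
      have "lower_inv i (Suc m) (set_ivar (Local 1) (Suc m) (set_ivar (Local 2) 1
          (set_cell (Work 0) 0 ?l s)))"
        using has_minimum_first[OF min[unfolded empty] True] inv
        by (simp add: lower_inv_def column_inv_def loaded_def sound_def set_ivar_def set_cell_def)
      then show ?thesis using True empty m unfolding lower_step_def
        by (simp add: exps[unfolded One_nat_def] del: rval.simps)
        (simp add: set_ivar_def set_cell_def)
    next
      case False
      have "lower_inv i (Suc m) (set_ivar (Local 1) (Suc m)
          (set_cell (Work 0) 0 (min (cells s (Work 0) 0) ?l) s))"
        using has_minimum_next[OF min False True] inv False
        by (simp add: lower_inv_def column_inv_def loaded_def sound_def set_ivar_def set_cell_def)
      moreover have "rval (RMin (reg 0) lower_bound_exp) s = min (cells s (Work 0) 0) ?l"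
        using exps(3) by simp
      ultimately show ?thesis using True False m unfolding lower_step_def
        by (simp add: exps[unfolded One_nat_def] del: rval.simps)
        (simp add: set_ivar_def set_cell_def)
    qed
  qed
qed

text \<open>The minimum is attained at an admissible column, which then serves the third
  row.\<close>

lemma compatible_imp_image_point:
  assumes "has_minimum i n f l" "f \<noteq> 0" "i < n" "j < n" "compatible a b c i j l"
  shows "image_point a b c n (min (floor_diff a c i) (l + floor_diff a b i)) l"
proof -
  obtain k where "k < n" "a k - c k \<le> floor_diff a c i" "l = lower_bound a b c i k"
    using assms(1) unfolding has_minimum_def if_not_P[OF assms(2)] by blast
  then show ?thesis using image_pointI[of i n j k] assms(3-5) by simp
qed

lemma upper_step:
  assumes "upper_inv i m s" "i < n" "m < n"
  shows "terminates_with upper_step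
    (\<lambda>t s'. t \<le> 100 \<and> upper_inv i (Suc m) (set_ivar (Local 1) (Suc (ivars s' (Local 1))) s')) s"
proof -
  let ?l = "cells s (Work 0) 0"
  have m: "ivars s (Local 1) = m" and inv: "column_inv i s"
    using assms(1) by (simp_all add: upper_inv_def)
  have exps: "rval (RMinus (entry 1 1) (entry 0 1)) s = b m - a m"
    "rval (RMinus RZero (floor_diff_exp 0 1)) s = - floor_diff a b i"
    "rval upper_bound_exp s = upper_bound a b c i m"
    "rval (RMin (floor_diff_exp 0 2) (RPlus (reg 0) (floor_diff_exp 0 1))) s =
      min (floor_diff a c i) (?l + floor_diff a b i)"
    "rval (reg 0) s = ?l"
    using m inv by (simp_all add: column_inv_def loaded_def floor_diff_def upper_bound_def)
  show ?thesis
  proof (cases "ivars s (Local 2) \<noteq> 0 \<and> compatible a b c i m ?l")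
    case False
    then have "upper_inv i (Suc m) (set_ivar (Local 1) (Suc m) s)"
      using assms(1) by (auto simp: invs less_Suc_eq)
    then show ?thesis using False m unfolding upper_step_def compatible_def
      by (auto simp: exps[unfolded One_nat_def] simp del: rval.simps)
  next
    case True
    then have "image_point a b c n (min (floor_diff a c i) (?l + floor_diff a b i)) ?l"
      using compatible_imp_image_point assms unfolding upper_inv_def by blast
    \<comment> \<open>A nonzero \<open>Verdict\<close> makes the claims about rejected columns
      vacuous; only the validity of the new point remains.\<close>
    then have "upper_inv i (Suc m) (set_ivar (Local 1) (Suc m) (set_ivar Verdict 1
        (set_cell (Work 2) 0 ?l
          (set_cell (Work 1) 0 (min (floor_diff a c i) (?l + floor_diff a b i)) s))))"
      using assms(1) True by (simp add: invs)
    then show ?thesis using True m unfolding upper_step_def compatible_def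
      by (simp add: exps[unfolded One_nat_def] del: rval.simps)
        (simp add: set_ivar_def set_cell_def)
  qed
qed

text \<open>A pair \<open>j\<close>, \<open>k\<close> against refutation would make \<open>j\<close>
  compatible with the stored minimum, which lies below the bound of \<open>k\<close>; but the loop
  has rejected every column for that minimum.\<close>

lemma upper_inv_imp_refuted:
  assumes "upper_inv i n s" "ivars s Verdict = 0"
  shows "refuted i"
  unfolding refuted_def
proof clarify
  fix j k
  assume jk: "j < n" "k < n" "a k - c k \<le> floor_diff a c i"
    and compatible: "\<forall>l \<le> lower_bound a b c i k. compatible a b c i j l"
  have min: "has_minimum i n (ivars s (Local 2)) (cells s (Work 0) 0)"
    using assms(1) by (simp add: upper_inv_def)
  have flag: "ivars s (Local 2) \<noteq> 0"
    using min jk unfolding has_minimum_def by presburger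
  have "cells s (Work 0) 0 \<le> lower_bound a b c i k"
    using min jk unfolding has_minimum_def if_not_P[OF flag] by blast
  then have "compatible a b c i j (cells s (Work 0) 0)" using compatible by blast
  then show False using assms flag jk(1) unfolding upper_inv_def by blast
qed

text \<open>The cost is 2 for resetting the flag and 5 + 107 n for each of the two inner
  loops.\<close>

lemma column_step:
  assumes "column_inv i s" "i < n"
  shows "terminates_with column_step (\<lambda>t s'. t \<le> 12 + 2 * (n * 107) \<and>
    column_inv (Suc i) (set_ivar (Local 0) (Suc (ivars s' (Local 0))) s')) s"
  unfolding column_step_def terminates_with_simps
proof (rule terminates_with_for_loop[where I = "lower_inv i" and n = n and K = 100])
  \<comment> \<open>With flag 0 and no column seen, the value left in \<open>Work 0\<close> by an
    earlier column is harmless.\<close>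
  show "lower_inv i 0 (set_ivar (Local 1) 0 (set_ivar (Local 2) (ival (IConst 0) s) s))"
    using assms by (simp add: invs has_minimum_def)
  fix t s'
  assume t: "t \<le> 5 + n * (100 + 7)" and s': "lower_inv i n s'"
  show "terminates_with (for_loop (Local 1) upper_step) (\<lambda>u s''.
      1 + icost (IConst 0) + (t + u) \<le> 12 + 2 * (n * 107) \<and>
      column_inv (Suc i) (set_ivar (Local 0) (Suc (ivars s'' (Local 0))) s'')) s'"
  proof (rule terminates_with_for_loop[where I = "upper_inv i" and n = n and K = 100])
    show "upper_inv i 0 (set_ivar (Local 1) 0 s')"
      using s' by (simp add: invs)
    fix u s''
    assume u: "u \<le> 5 + n * (100 + 7)" and s'': "upper_inv i n s''"
    then have "ivars s'' Verdict = 0 \<longrightarrow> refuted i" using upper_inv_imp_refuted by blast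
    then show "1 + icost (IConst 0) + (t + u) \<le> 12 + 2 * (n * 107) \<and>
        column_inv (Suc i) (set_ivar (Local 0) (Suc (ivars s'' (Local 0))) s'')"
      using t u s'' by (auto simp: invs less_Suc_eq)
  qed (blast intro: upper_step assms(2) dest: inv_index)+
qed (blast intro: lower_step dest: inv_index)+

lemma output_step:
  assumes "output_inv m s" "m < n"
  shows "terminates_with output_step
    (\<lambda>t s'. t \<le> 100 \<and> output_inv (Suc m) (set_ivar (Local 1) (Suc (ivars s' (Local 1))) s')) s"
  using assms unfolding output_step_def by (auto simp: invs less_Suc_eq)

text \<open>The bound adds 5 + n (12 + 214 n + 7) for the search and 5 + 107 n for the
  output.\<close>

lemma solver:
  assumes "loaded s" "ivars s Verdict = 0"
  shows "terminates_with solver (\<lambda>t s'. t \<le> 10 + n * 126 + n * n * 214 \<and> output_inv n s') s"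
  unfolding solver_def terminates_with_simps
proof (rule terminates_with_for_loop[where I = column_inv and n = n and K = "12 + 2 * (n * 107)"])
  show "column_inv 0 (set_ivar (Local 0) 0 s)" using assms by (simp add: invs)
  fix t s'
  assume t: "t \<le> 5 + n * (12 + 2 * (n * 107) + 7)" and s': "column_inv n s'"
  show "terminates_with (for_loop (Local 1) output_step)
    (\<lambda>u s''. t + u \<le> 10 + n * 126 + n * n * 214 \<and> output_inv n s'') s'"
  proof (rule terminates_with_for_loop[where I = output_inv and n = n and K = 100])
    show "output_inv 0 (set_ivar (Local 1) 0 s')" using s' by (simp add: invs)
    fix u s''
    assume "u \<le> 5 + n * (100 + 7)" "output_inv n s''"
    then show "t + u \<le> 10 + n * 126 + n * n * 214 \<and> output_inv n s''"
      using t by (simp add: algebra_simps)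
  qed (blast intro: output_step dest: inv_index)+
qed (blast intro: column_step dest: inv_index)+

lemma output_inv_final:
  assumes "output_inv n s"
  shows "ivars s Verdict = 0 \<Longrightarrow> \<not> image_point a b c n u v"
    and "ivars s Verdict \<noteq> 0 \<Longrightarrow> image_point a b c n (cells s (Work 1) 0) (cells s (Work 2) 0)"
    and "j < n \<Longrightarrow> cells s Output j =
      min (cells s (Work 1) 0 - a j) (min (cells s (Work 2) 0 - b j) (- c j))"
proof -
  assume "ivars s Verdict = 0"
  then have "\<forall>i<n. refuted i" using assms by (simp add: invs)
  \<comment> \<open>An image point would provide a first-row column \<open>i\<close> that is not
    refuted.\<close>
  then show "\<not> image_point a b c n u v" unfolding refuted_def by (meson image_pointE)
qed (use assms in \<open>simp_all add: invs\<close>)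

end

section \<open>Quadratic running time and correctness of the answer\<close>

theorem mainTheorem1:
  "\<exists>(c :: com) (T :: nat \<Rightarrow> nat).
     (\<lambda>n. real (T n)) \<in> O(\<lambda>n. real n ^ 2) \<and>
     (\<forall>n \<ge> 1. \<forall>A \<in> carrier_mat 3 n. column_typical A \<longrightarrow>
        (\<exists>t s. exec c (initial_state A) t s \<and> t \<le> T n \<and>
           (case answer n s of
              Some x \<Rightarrow> integral_vec (A \<otimes>\<^sub>m x)
            | None \<Rightarrow> \<not> (\<exists>x \<in> carrier_vec n. integral_vec (A \<otimes>\<^sub>m x)))))"
proof (intro exI[of _ solver] exI[of _ "\<lambda>n. 10 + n * 126 + n * n * 214"] conjI allI ballI impI)
  show "(\<lambda>n. real (10 + n * 126 + n * n * 214)) \<in> O(\<lambda>n. real n ^ 2)"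
  \<comment> \<open>350 = 10 + 126 + 214, since 1 and n are at most n * n for positive n.\<close>
  proof (rule bigoI[where c = 350], rule eventually_mono[OF eventually_ge_at_top[of 1]])
    fix n :: nat
    assume "1 \<le> n"
    then have "n \<le> n * n" "1 \<le> n * n" by simp_all
    then have "10 + n * 126 + n * n * 214 \<le> 350 * (n * n)" by linarith
    then have "real (10 + n * 126 + n * n * 214) \<le> real (350 * (n * n))"
      by (simp only: of_nat_le_iff)
    then show "norm (real (10 + n * 126 + n * n * 214)) \<le> 350 * norm (real n ^ 2)"
      by (simp add: power2_eq_square)
  qed
next
  fix n :: nat and A :: "real mat"
  assume "n \<ge> 1" and A: "A \<in> carrier_mat 3 n"
  define row where "row i = cells (initial_state A) (Input i)" for i
  have row: "row i j = A $$ (i, j)" if "i < 3" "j < n" for i j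
    using A that unfolding row_def initial_state_def by auto
  \<comment> \<open>The input arrays are known to agree with the matrix rows only below
    \<open>n\<close>, and \<open>image_point\<close> inspects no other columns.\<close>
  have cong: "image_point (row 0) (row 1) (row 2) n =
      image_point (\<lambda>j. A $$ (0, j)) (\<lambda>j. A $$ (1, j)) (\<lambda>j. A $$ (2, j)) n"
    unfolding image_point_def by (simp add: row cong: conj_cong)
  interpret three_rows "row 0" "row 1" "row 2" n .
  have "loaded (initial_state A)" "ivars (initial_state A) Verdict = 0"
    unfolding loaded_def using A by (auto simp: row_def initial_state_def)
  from solver[OF this] obtain t s where exec: "exec solver (initial_state A) t s"
    and t: "t \<le> 10 + n * 126 + n * n * 214" and s: "output_inv n s"
    unfolding terminates_with_def by blast
  have "case answer n s of Some x \<Rightarrow> integral_vec (A \<otimes>\<^sub>m x)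
    | None \<Rightarrow> \<not> (\<exists>x \<in> carrier_vec n. integral_vec (A \<otimes>\<^sub>m x))"
  proof (cases "ivars s Verdict = 0")
    case True
    then have "\<not> image_point (row 0) (row 1) (row 2) n u v" for u v
      by (rule output_inv_final(1)[OF s])
    then show ?thesis
      using True solution_image_point[OF A \<open>n \<ge> 1\<close>] unfolding answer_def cong by auto
  next
    case False
    then have "image_point (row 0) (row 1) (row 2) n (cells s (Work 1) 0) (cells s (Work 2) 0)"
      by (rule output_inv_final(2)[OF s])
    moreover have "cells s Output j = min (cells s (Work 1) 0 - A $$ (0, j))
        (min (cells s (Work 2) 0 - A $$ (1, j)) (- A $$ (2, j)))" if "j < n" for j
      using output_inv_final(3)[OF s that] that by (simp add: row)
    ultimately have "integral_vec (A \<otimes>\<^sub>m vec n (cells s Output))"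
      using image_point_solution[OF A] unfolding cong by simp
    then show ?thesis using False unfolding answer_def by simp
  qed
  then show "\<exists>t s. exec solver (initial_state A) t s \<and> t \<le> 10 + n * 126 + n * n * 214 \<and>
      (case answer n s of Some x \<Rightarrow> integral_vec (A \<otimes>\<^sub>m x)
       | None \<Rightarrow> \<not> (\<exists>x \<in> carrier_vec n. integral_vec (A \<otimes>\<^sub>m x)))"
    using exec t by blast
qed

end
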